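(* Let $|\psi\rangle_{AB}\in\mathbb{C}^2\otimes\mathbb{C}^2$ be a product state orthogonal to $|00\rangle_{AB}$. Then either $|\psi\rangle_{AB}=|\alpha\rangle_A\otimes|1\rangle_B$ for some unit vector $|\alpha\rangle\in\mathbb{C}^2$, or $|\psi\rangle_{AB}=|1\rangle_A\otimes|\beta\rangle_B$ for some unit vector $|\beta\rangle\in\mathbb{C}^2$. Conversely, for arbitrary unit vectors $|\alpha\rangle,|\beta\rangle\in\mathbb{C}^2$, both of these are product states orthogonal to $|00\rangle_{AB}$.
   Context: $|0\rangle,|1\rangle$ is the standard basis of $\mathbb{C}^2$ and $|jk\rangle_{AB}=|j\rangle_A\otimes|k\rangle_B$. A state is a unit vector; a state in $\mathbb{C}^2\otimes\mathbb{C}^2$ is a product state if it equals $|u\rangle\otimes|v\rangle$ for some $|u\rangle,|v\rangle\in\mathbb{C}^2$. *)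

theory Defs
  imports "HOL-Analysis.Analysis"
begin

text \<open>The inner product that \<open>HOL-Analysis\<close> provides on \<^typ>\<open>complex ^ 'n\<close> is the real one,
  i.e. the real part of the Hermitian inner product below, so the library's notion of
  orthogonality is strictly weaker than the intended one. The library norm, on the other hand,
  is the norm induced by the Hermitian inner product.\<close>

definition cinner_vec :: "complex ^ 'n \<Rightarrow> complex ^ 'n \<Rightarrow> complex" where
  "cinner_vec x y = (\<Sum>i\<in>UNIV. cnj (x $ i) * y $ i)"

definition corthogonal :: "complex ^ 'n \<Rightarrow> complex ^ 'n \<Rightarrow> bool" where
  "corthogonal x y \<longleftrightarrow> cinner_vec x y = 0"

text \<open>The tensor product of the coordinate spaces is the coordinate space indexed by pairs.\<close>

definition tensor_vec :: "complex ^ 'm \<Rightarrow> complex ^ 'n \<Rightarrow> complex ^ ('m \<times> 'n)"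
    (infixr "\<otimes>" 70) where
  "u \<otimes> v = (\<chi> p. u $ fst p * v $ snd p)"

text \<open>The index type \<^typ>\<open>2\<close> has exactly the two elements \<open>0\<close> and \<open>1\<close>.\<close>

definition ket :: "2 \<Rightarrow> complex ^ 2" where
  "ket j = axis j 1"

definition ket2 :: "2 \<Rightarrow> 2 \<Rightarrow> complex ^ (2 \<times> 2)" where
  "ket2 j k = ket j \<otimes> ket k"

definition is_state :: "complex ^ 'n \<Rightarrow> bool" where
  "is_state x \<longleftrightarrow> norm x = 1"

definition is_product_state :: "complex ^ (2 \<times> 2) \<Rightarrow> bool" where
  "is_product_state \<psi> \<longleftrightarrow> is_state \<psi> \<and> (\<exists>(u :: complex ^ 2) (v :: complex ^ 2). \<psi> = u \<otimes> v)"

end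

theory Submission imports Defs begin

text \<open>The amplitude of \<open>u \<otimes> v\<close> at \<open>(0, 0)\<close> is
  \<open>u $ 0 * v $ 0\<close>, so orthogonality to \<open>ket2 0 0\<close> forces one factor to
  have vanishing 0-coordinate (\<open>corthogonal_tensor_vec_ket2\<close>). In dimension two that
  factor is a multiple of \<open>ket 1\<close> (\<open>eq_scaled_ket_1\<close>), and bilinearity
  moves the scalar into the other factor. Since the norm is multiplicative
  (\<open>norm_tensor_vec\<close>) and \<open>ket 1\<close> is a unit vector, the rescaled factor is
  itself a state. The converse reads the same equivalences backwards.\<close>

lemma norm_tensor_vec: "norm (u \<otimes> v) = norm u * norm v"
proof -
  have "(\<Sum>p\<in>UNIV. (norm ((u \<otimes> v) $ p))\<^sup>2)
      = (\<Sum>i\<in>UNIV. \<Sum>j\<in>UNIV. (norm (u $ i))\<^sup>2 * (norm (v $ j))\<^sup>2)"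
    \<comment> \<open>Viewing the index type of pairs as a Cartesian product turns the iterated sum
      into a sum over pairs, so the two sides can be compared termwise.\<close>
    unfolding UNIV_Times_UNIV [symmetric] sum.cartesian_product
    by (auto simp: tensor_vec_def norm_mult power_mult_distrib intro!: sum.cong)
  also have "\<dots> = (\<Sum>i\<in>UNIV. (norm (u $ i))\<^sup>2) * (\<Sum>j\<in>UNIV. (norm (v $ j))\<^sup>2)"
    by (simp add: sum_product)
  finally show ?thesis
    by (simp add: norm_vec_def L2_set_def real_sqrt_mult)
qed

lemma norm_ket: "norm (ket j) = 1"
  by (simp add: ket_def)

lemma ket2_eq_axis: "ket2 j k = axis (j, k) 1"
  by (auto simp: ket2_def ket_def tensor_vec_def axis_def vec_eq_iff)

lemma cinner_vec_axis: "cinner_vec x (axis i 1) = cnj (x $ i)"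
proof -
  have "cinner_vec x (axis i 1) = (\<Sum>j\<in>UNIV. if j = i then cnj (x $ j) else 0)"
    unfolding cinner_vec_def by (intro sum.cong) (auto simp: axis_def)
  then show ?thesis by simp
qed

text \<open>Pairing with a basis vector reads off one coordinate up to conjugation; here it is
  \<open>u $ j * v $ k\<close>, and the complex numbers have no zero divisors.\<close>

lemma corthogonal_tensor_vec_ket2:
  "corthogonal (u \<otimes> v) (ket2 j k) \<longleftrightarrow> u $ j = 0 \<or> v $ k = 0"
  by (simp add: corthogonal_def ket2_eq_axis cinner_vec_axis) (simp add: tensor_vec_def)

lemma eq_scaled_ket_1:
  fixes v :: "complex ^ 2"
  assumes "v $ 0 = 0"
  shows "v = v $ 1 *s ket 1"
proof -
  \<comment> \<open>\<open>forall_2\<close> enumerates the index type as \<open>1\<close> and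
    \<open>2\<close>, so the hypothesis at \<open>0\<close> has to be transported to
    \<open>2\<close>, which is the same element modulo 2.\<close>
  have "(2 :: 2) = 0" by simp
  with assms have "v $ 2 = 0" by metis
  then show ?thesis
    by (simp add: vec_eq_iff ket_def axis_def forall_2)
qed

lemma tensor_vec_scale_left: "(c *s u) \<otimes> v = c *s (u \<otimes> v)"
  by (simp add: tensor_vec_def vec_eq_iff)

lemma tensor_vec_scale_right: "u \<otimes> (c *s v) = c *s (u \<otimes> v)"
  by (simp add: tensor_vec_def vec_eq_iff)

text \<open>Tensoring with a unit vector preserves the norm. The equivalence serves both directions
  of the theorem: normalising the factor extracted from a state, and building a state from a
  factor.\<close>

lemma is_state_tensor_vec_ket: "is_state (u \<otimes> ket j) \<longleftrightarrow> is_state u"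
  by (simp add: is_state_def norm_tensor_vec norm_ket)

lemma is_state_ket_tensor_vec: "is_state (ket j \<otimes> v) \<longleftrightarrow> is_state v"
  by (simp add: is_state_def norm_tensor_vec norm_ket)

theorem proposition3:
  "(\<forall>\<psi> :: complex ^ (2 \<times> 2). is_product_state \<psi> \<and> corthogonal \<psi> (ket2 0 0) \<longrightarrow>
      (\<exists>\<alpha> :: complex ^ 2. is_state \<alpha> \<and> \<psi> = \<alpha> \<otimes> ket 1) \<or>
      (\<exists>\<beta> :: complex ^ 2. is_state \<beta> \<and> \<psi> = ket 1 \<otimes> \<beta>)) \<and>
   (\<forall>(\<alpha> :: complex ^ 2) (\<beta> :: complex ^ 2). is_state \<alpha> \<and> is_state \<beta> \<longrightarrow>
      (is_product_state (\<alpha> \<otimes> ket 1) \<and> corthogonal (\<alpha> \<otimes> ket 1) (ket2 0 0)) \<and>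
      (is_product_state (ket 1 \<otimes> \<beta>) \<and> corthogonal (ket 1 \<otimes> \<beta>) (ket2 0 0)))"
proof (intro conjI allI impI)
  fix \<psi> :: "complex ^ (2 \<times> 2)"
  assume *: "is_product_state \<psi> \<and> corthogonal \<psi> (ket2 0 0)"
  then obtain u v :: "complex ^ 2" where \<psi>: "\<psi> = u \<otimes> v" and state: "is_state \<psi>"
    by (auto simp: is_product_state_def)
  from * consider "v $ 0 = 0" | "u $ 0 = 0"
    by (auto simp: \<psi> corthogonal_tensor_vec_ket2)
  then show "(\<exists>\<alpha>. is_state \<alpha> \<and> \<psi> = \<alpha> \<otimes> ket 1) \<or> (\<exists>\<beta>. is_state \<beta> \<and> \<psi> = ket 1 \<otimes> \<beta>)"
  proof cases
    case 1
    \<comment> \<open>The given \<open>u\<close> and \<open>v\<close> need not be unit vectors, only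
      their norms multiply to 1. Hence the witness is \<open>u\<close> rescaled by the coefficient
      in \<open>v = v $ 1 *s ket 1\<close>.\<close>
    then have "\<psi> = (v $ 1 *s u) \<otimes> ket 1"
      by (metis \<psi> eq_scaled_ket_1 tensor_vec_scale_left tensor_vec_scale_right)
    with state show ?thesis
      by (metis is_state_tensor_vec_ket)
  next
    case 2
    \<comment> \<open>The mirror image: now \<open>u\<close> is the multiple of
      \<open>ket 1\<close>, and \<open>v\<close> absorbs its coefficient.\<close>
    then have "\<psi> = ket 1 \<otimes> (u $ 1 *s v)"
      by (metis \<psi> eq_scaled_ket_1 tensor_vec_scale_left tensor_vec_scale_right)
    with state show ?thesis
      by (metis is_state_ket_tensor_vec)
  qed
next
  have ket_1_0: "ket 1 $ 0 = 0"
    by (simp add: ket_def axis_def)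
  fix \<alpha> \<beta> :: "complex ^ 2"
  assume "is_state \<alpha> \<and> is_state \<beta>"
  then show "is_product_state (\<alpha> \<otimes> ket 1)" "is_product_state (ket 1 \<otimes> \<beta>)"
    by (auto simp: is_product_state_def is_state_tensor_vec_ket is_state_ket_tensor_vec)
  show "corthogonal (\<alpha> \<otimes> ket 1) (ket2 0 0)" "corthogonal (ket 1 \<otimes> \<beta>) (ket2 0 0)"
    by (simp_all add: corthogonal_tensor_vec_ket2 ket_1_0)
qed

end
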